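(* Let $(X,\unlhd,\wedge,\vee,0,1)$ be a bounded trellis and $T^*$ a pseudo-t-norm on $X$. If $T^*$ is $T$-distributive for every pseudo-t-norm $T$ on $X$, then $T^*$ is a t-norm on $X$.
   Context: A pseudo-order $\unlhd$ on a set $X$ is a reflexive and antisymmetric relation (not necessarily transitive); lower/upper bounds, infima and suprema are defined as for partially ordered sets (they are unique when they exist). A trellis $(X,\unlhd,\wedge,\vee)$ is a set with a pseudo-order in which any two elements $x,y$ have an infimum $x\wedge y$ and a supremum $x\vee y$. It is bounded, written $(X,\unlhd,\wedge,\vee,0,1)$, if it has elements $0,1$ with $0\unlhd x\unlhd 1$ for all $x\in X$. An element $\alpha\in X$ is right-transitive if $\alpha\unlhd x\unlhd y$ implies $\alpha\unlhd y$; left-transitive if $x\unlhd y\unlhd\alpha$ implies $x\unlhd\alpha$; middle-transitive if $x\unlhd\alpha\unlhd y$ implies $x\unlhd y$ (for all $x,y\in X$); transitive if all three hold. A triple $(x,y,z)$ is $\wedge$-associative if $(x\wedge y)\wedge z=x\wedge(y\wedge z)$, and $\vee$-associative if $(x\vee y)\vee z=x\vee(y\vee z)$. An element is $\wedge$-associative (resp. $\vee$-associative) if every triple in $X^3$ containing it is $\wedge$-associative (resp. $\vee$-associative). A binary operation $F$ on $X$ is weakly-increasing if, whenever $x\unlhd y$ and at least one of $x,y$ is transitive, $F(x,z)\unlhd F(y,z)$ for all $z\in X$. It is weakly-associative if $F(x,F(y,z))=F(F(x,y),z)$ for all $x,y,z\in X$ such that at least one of $x,y,z$ is $\wedge$-associative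 or at least one of $x,y,z$ is $\vee$-associative. A pseudo-t-norm on $X$ is a commutative, weakly-increasing, weakly-associative binary operation $T$ with $T(1,x)=x$ for all $x\in X$. A t-norm on $X$ is a commutative, associative binary operation $T$ that is increasing ($x\unlhd y$ implies $T(x,z)\unlhd T(y,z)$ for all $z\in X$) and satisfies $T(1,x)=x$ for all $x\in X$. For binary operations $F_1,F_2$ on $X$, $F_1$ is $F_2$-distributive if $F_1(x,F_2(y,z))=F_2(F_1(x,y),F_1(x,z))$ for all $x,y,z\in X$ with $(y,z)\neq(0,0)$ and $(y,z)\neq(1,1)$. *)

theory Defs
  imports Main
begin

text \<open>
  A trellis lives on a carrier set \<open>X\<close> inside a type; \<open>le\<close> is the pseudo-order. Relations and
  operations are only ever constrained on \<open>X\<close>, so their values outside \<open>X\<close> are irrelevant.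
\<close>

locale pseudo_order =
  fixes X :: "'a set" and le :: "'a \<Rightarrow> 'a \<Rightarrow> bool"
  assumes refl: "reflp_on X le"
    and antisym: "antisymp_on X le"

definition lower_bound :: "'a set \<Rightarrow> ('a \<Rightarrow> 'a \<Rightarrow> bool) \<Rightarrow> 'a set \<Rightarrow> 'a \<Rightarrow> bool" where
  "lower_bound X le A b \<longleftrightarrow> b \<in> X \<and> (\<forall>a\<in>A. le b a)"

definition upper_bound :: "'a set \<Rightarrow> ('a \<Rightarrow> 'a \<Rightarrow> bool) \<Rightarrow> 'a set \<Rightarrow> 'a \<Rightarrow> bool" where
  "upper_bound X le A b \<longleftrightarrow> b \<in> X \<and> (\<forall>a\<in>A. le a b)"

definition is_infimum :: "'a set \<Rightarrow> ('a \<Rightarrow> 'a \<Rightarrow> bool) \<Rightarrow> 'a set \<Rightarrow> 'a \<Rightarrow> bool" where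
  "is_infimum X le A m \<longleftrightarrow> lower_bound X le A m \<and> (\<forall>b. lower_bound X le A b \<longrightarrow> le b m)"

definition is_supremum :: "'a set \<Rightarrow> ('a \<Rightarrow> 'a \<Rightarrow> bool) \<Rightarrow> 'a set \<Rightarrow> 'a \<Rightarrow> bool" where
  "is_supremum X le A m \<longleftrightarrow> upper_bound X le A m \<and> (\<forall>b. upper_bound X le A b \<longrightarrow> le m b)"

locale trellis = pseudo_order X le
  for X :: "'a set" and le :: "'a \<Rightarrow> 'a \<Rightarrow> bool" +
  fixes meet join :: "'a \<Rightarrow> 'a \<Rightarrow> 'a"
  assumes meet_infimum: "\<And>x y. x \<in> X \<Longrightarrow> y \<in> X \<Longrightarrow> is_infimum X le {x, y} (meet x y)"
    and join_supremum: "\<And>x y. x \<in> X \<Longrightarrow> y \<in> X \<Longrightarrow> is_supremum X le {x, y} (join x y)"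

locale bounded_trellis = trellis X le meet join
  for X :: "'a set" and le :: "'a \<Rightarrow> 'a \<Rightarrow> bool" and meet join :: "'a \<Rightarrow> 'a \<Rightarrow> 'a" +
  fixes zero one :: 'a
  assumes zero_in: "zero \<in> X"
    and one_in: "one \<in> X"
    and zero_le: "\<And>x. x \<in> X \<Longrightarrow> le zero x"
    and le_one: "\<And>x. x \<in> X \<Longrightarrow> le x one"

definition right_transitive :: "'a set \<Rightarrow> ('a \<Rightarrow> 'a \<Rightarrow> bool) \<Rightarrow> 'a \<Rightarrow> bool" where
  "right_transitive X le a \<longleftrightarrow> (\<forall>x\<in>X. \<forall>y\<in>X. le a x \<and> le x y \<longrightarrow> le a y)"

definition left_transitive :: "'a set \<Rightarrow> ('a \<Rightarrow> 'a \<Rightarrow> bool) \<Rightarrow> 'a \<Rightarrow> bool" where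
  "left_transitive X le a \<longleftrightarrow> (\<forall>x\<in>X. \<forall>y\<in>X. le x y \<and> le y a \<longrightarrow> le x a)"

definition middle_transitive :: "'a set \<Rightarrow> ('a \<Rightarrow> 'a \<Rightarrow> bool) \<Rightarrow> 'a \<Rightarrow> bool" where
  "middle_transitive X le a \<longleftrightarrow> (\<forall>x\<in>X. \<forall>y\<in>X. le x a \<and> le a y \<longrightarrow> le x y)"

definition transitive_element :: "'a set \<Rightarrow> ('a \<Rightarrow> 'a \<Rightarrow> bool) \<Rightarrow> 'a \<Rightarrow> bool" where
  "transitive_element X le a \<longleftrightarrow>
     right_transitive X le a \<and> left_transitive X le a \<and> middle_transitive X le a"

text \<open>
  Used with \<open>F = meet\<close> and \<open>F = join\<close>, giving meet-associative and join-associative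
  triples and elements.
\<close>

definition associative_triple :: "('a \<Rightarrow> 'a \<Rightarrow> 'a) \<Rightarrow> 'a \<Rightarrow> 'a \<Rightarrow> 'a \<Rightarrow> bool" where
  "associative_triple F x y z \<longleftrightarrow> F (F x y) z = F x (F y z)"

definition associative_element :: "'a set \<Rightarrow> ('a \<Rightarrow> 'a \<Rightarrow> 'a) \<Rightarrow> 'a \<Rightarrow> bool" where
  "associative_element X F a \<longleftrightarrow>
     (\<forall>x\<in>X. \<forall>y\<in>X. \<forall>z\<in>X. a \<in> {x, y, z} \<longrightarrow> associative_triple F x y z)"

definition binary_operation :: "'a set \<Rightarrow> ('a \<Rightarrow> 'a \<Rightarrow> 'a) \<Rightarrow> bool" where
  "binary_operation X F \<longleftrightarrow> (\<forall>x\<in>X. \<forall>y\<in>X. F x y \<in> X)"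

definition commutative_op :: "'a set \<Rightarrow> ('a \<Rightarrow> 'a \<Rightarrow> 'a) \<Rightarrow> bool" where
  "commutative_op X F \<longleftrightarrow> (\<forall>x\<in>X. \<forall>y\<in>X. F x y = F y x)"

definition associative_op :: "'a set \<Rightarrow> ('a \<Rightarrow> 'a \<Rightarrow> 'a) \<Rightarrow> bool" where
  "associative_op X F \<longleftrightarrow> (\<forall>x\<in>X. \<forall>y\<in>X. \<forall>z\<in>X. F x (F y z) = F (F x y) z)"

definition increasing_op :: "'a set \<Rightarrow> ('a \<Rightarrow> 'a \<Rightarrow> bool) \<Rightarrow> ('a \<Rightarrow> 'a \<Rightarrow> 'a) \<Rightarrow> bool" where
  "increasing_op X le F \<longleftrightarrow>
     (\<forall>x\<in>X. \<forall>y\<in>X. le x y \<longrightarrow> (\<forall>z\<in>X. le (F x z) (F y z)))"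

definition weakly_increasing :: "'a set \<Rightarrow> ('a \<Rightarrow> 'a \<Rightarrow> bool) \<Rightarrow> ('a \<Rightarrow> 'a \<Rightarrow> 'a) \<Rightarrow> bool" where
  "weakly_increasing X le F \<longleftrightarrow>
     (\<forall>x\<in>X. \<forall>y\<in>X. le x y \<and> (transitive_element X le x \<or> transitive_element X le y) \<longrightarrow>
        (\<forall>z\<in>X. le (F x z) (F y z)))"

definition weakly_associative ::
    "'a set \<Rightarrow> ('a \<Rightarrow> 'a \<Rightarrow> 'a) \<Rightarrow> ('a \<Rightarrow> 'a \<Rightarrow> 'a) \<Rightarrow> ('a \<Rightarrow> 'a \<Rightarrow> 'a) \<Rightarrow> bool" where
  "weakly_associative X meet join F \<longleftrightarrow>
     (\<forall>x\<in>X. \<forall>y\<in>X. \<forall>z\<in>X.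
        (\<exists>a\<in>{x, y, z}. associative_element X meet a) \<or>
        (\<exists>a\<in>{x, y, z}. associative_element X join a) \<longrightarrow>
        F x (F y z) = F (F x y) z)"

definition pseudo_t_norm ::
    "'a set \<Rightarrow> ('a \<Rightarrow> 'a \<Rightarrow> bool) \<Rightarrow> ('a \<Rightarrow> 'a \<Rightarrow> 'a) \<Rightarrow> ('a \<Rightarrow> 'a \<Rightarrow> 'a) \<Rightarrow> 'a \<Rightarrow>
     ('a \<Rightarrow> 'a \<Rightarrow> 'a) \<Rightarrow> bool" where
  "pseudo_t_norm X le meet join one T \<longleftrightarrow>
     binary_operation X T \<and> commutative_op X T \<and> weakly_increasing X le T \<and>
     weakly_associative X meet join T \<and> (\<forall>x\<in>X. T one x = x)"

definition t_norm ::
    "'a set \<Rightarrow> ('a \<Rightarrow> 'a \<Rightarrow> bool) \<Rightarrow> 'a \<Rightarrow> ('a \<Rightarrow> 'a \<Rightarrow> 'a) \<Rightarrow> bool" where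
  "t_norm X le one T \<longleftrightarrow>
     binary_operation X T \<and> commutative_op X T \<and> associative_op X T \<and>
     increasing_op X le T \<and> (\<forall>x\<in>X. T one x = x)"

text \<open>\<open>distributive_over X zero one F1 F2\<close>: the operation \<open>F1\<close> is \<open>F2\<close>-distributive.\<close>

definition distributive_over ::
    "'a set \<Rightarrow> 'a \<Rightarrow> 'a \<Rightarrow> ('a \<Rightarrow> 'a \<Rightarrow> 'a) \<Rightarrow> ('a \<Rightarrow> 'a \<Rightarrow> 'a) \<Rightarrow> bool" where
  "distributive_over X zero one F1 F2 \<longleftrightarrow>
     (\<forall>x\<in>X. \<forall>y\<in>X. \<forall>z\<in>X. (y, z) \<noteq> (zero, zero) \<and> (y, z) \<noteq> (one, one) \<longrightarrow>
        F1 x (F2 y z) = F2 (F1 x y) (F1 x z))"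

end

theory Submission
  imports Defs
begin

text \<open>
  The drastic product, which sends a pair to \<open>zero\<close> unless one of its entries is \<open>one\<close>, is a
  t-norm on every bounded trellis (\<open>drastic_product_t_norm\<close>): it is so degenerate that
  the extremal position of \<open>zero\<close> and \<open>one\<close> suffices for monotonicity. It is therefore one of the
  pseudo-t-norms over which \<open>Tstar\<close> distributes. Distributivity at the pair \<open>(one, z)\<close> with
  \<open>z \<noteq> one\<close> reads \<open>Tstar x z = D x (Tstar x z)\<close>, where \<open>D\<close> is the drastic product. If also
  \<open>x \<noteq> one\<close>, then \<open>Tstar x z \<noteq> one\<close>, because a pseudo-t-norm lies below its arguments; hence
  the right-hand side is \<open>zero\<close>. So \<open>Tstar\<close> agrees with the drastic product on \<open>X\<close> and is a
  t-norm.
\<close>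

definition drastic_product :: "'a \<Rightarrow> 'a \<Rightarrow> 'a \<Rightarrow> 'a \<Rightarrow> 'a" where
  "drastic_product zero one x y = (if x = one then y else if y = one then x else zero)"

lemma t_norm_cong:
  assumes "t_norm X le one S" and eq: "\<And>x y. x \<in> X \<Longrightarrow> y \<in> X \<Longrightarrow> T x y = S x y"
    and "one \<in> X"
  shows "t_norm X le one T"
proof -
  have closed: "S x y \<in> X" if "x \<in> X" "y \<in> X" for x y
    using assms(1) that unfolding t_norm_def binary_operation_def by blast
  have "binary_operation X T"
    using closed by (simp add: binary_operation_def eq)
  moreover have "commutative_op X T"
    using assms(1) unfolding t_norm_def commutative_op_def by (metis eq)
  moreover have "associative_op X T"
    unfolding associative_op_def
  proof (intro ballI)
    fix x y z assume xyz: "x \<in> X" "y \<in> X" "z \<in> X"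
    then have "S x (S y z) = S (S x y) z"
      using assms(1) unfolding t_norm_def associative_op_def by blast
    with xyz show "T x (T y z) = T (T x y) z"
      by (simp only: eq closed)
  qed
  moreover have "increasing_op X le T"
    using assms(1) by (simp add: t_norm_def increasing_op_def eq)
  moreover have "\<forall>x\<in>X. T one x = x"
    using assms(1,3) by (simp add: t_norm_def eq)
  ultimately show ?thesis
    by (simp add: t_norm_def)
qed

lemma t_norm_imp_pseudo_t_norm:
  "t_norm X le one T \<Longrightarrow> pseudo_t_norm X le meet join one T"
  unfolding t_norm_def pseudo_t_norm_def associative_op_def weakly_associative_def
    increasing_op_def weakly_increasing_def by blast

context bounded_trellis
begin

lemma one_le_iff: "x \<in> X \<Longrightarrow> le one x \<longleftrightarrow> x = one"
  using antisymp_onD[OF antisym, of one x] le_one one_in by blast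

lemma le_zero_iff: "x \<in> X \<Longrightarrow> le x zero \<longleftrightarrow> x = zero"
  using antisymp_onD[OF antisym, of zero x] zero_le zero_in by blast

lemma transitive_element_one: "transitive_element X le one"
  unfolding transitive_element_def right_transitive_def left_transitive_def
    middle_transitive_def
  using one_le_iff le_one by blast

text \<open>
  Monotonicity: if \<open>D x z\<close> is not \<open>zero\<close>, then \<open>z = one\<close>, where
  \<open>D\<close> returns the other argument, or \<open>x = one\<close>, which forces \<open>y = one\<close> for every \<open>y\<close> above
  \<open>x\<close>. In a triple without \<open>one\<close>, both ways of bracketing give \<open>zero\<close>.
\<close>

lemma drastic_product_t_norm: "t_norm X le one (drastic_product zero one)"
proof -
  let ?D = "drastic_product zero one"
  have refl': "le x x" if "x \<in> X" for x
    using refl that by (rule reflp_onD)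
  have "binary_operation X ?D" "commutative_op X ?D"
    using zero_in by (auto simp: binary_operation_def commutative_op_def drastic_product_def)
  moreover have "associative_op X ?D"
  proof -
    \<comment> \<open>If \<open>zero = one\<close>, a product with \<open>zero\<close> is a product with the unit, so the inner
      value \<open>zero\<close> need not propagate; \<open>X\<close> is then a singleton.\<close>
    have "x = y" if "zero = one" "x \<in> X" "y \<in> X" for x y
      using that le_one[of x] le_one[of y] le_zero_iff[of x] le_zero_iff[of y] by simp
    then show ?thesis
      using zero_in by (simp add: associative_op_def drastic_product_def)
  qed
  moreover have "increasing_op X le ?D"
    unfolding increasing_op_def
  proof (intro ballI impI)
    fix x y z assume "x \<in> X" "y \<in> X" "z \<in> X" "le x y"
    then show "le (?D x z) (?D y z)"
      using le_one one_le_iff[of y] zero_le zero_in refl'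
      by (cases "x = one"; cases "y = one"; cases "z = one") (simp_all add: drastic_product_def)
  qed
  ultimately show ?thesis
    by (simp add: t_norm_def drastic_product_def)
qed

text \<open>
  The element \<open>one\<close> is transitive, so weak monotonicity applies to \<open>le x one\<close>.
\<close>

lemma pseudo_t_norm_le_right:
  assumes "pseudo_t_norm X le meet join one T" "x \<in> X" "z \<in> X"
  shows "le (T x z) z"
proof -
  have "le (T x z) (T one z)"
    using assms transitive_element_one le_one[OF assms(2)] one_in
    unfolding pseudo_t_norm_def weakly_increasing_def by blast
  then show ?thesis
    using assms by (simp add: pseudo_t_norm_def)
qed

lemma distributive_over_drastic_product_imp_eq:
  assumes T: "pseudo_t_norm X le meet join one T"
    and dist: "distributive_over X zero one T (drastic_product zero one)"
    and x: "x \<in> X" and z: "z \<in> X"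
  shows "T x z = drastic_product zero one x z"
proof -
  have unit: "T one y = y" "T y one = y" if "y \<in> X" for y
    using T that one_in by (auto simp: pseudo_t_norm_def commutative_op_def)
  show ?thesis
  proof (cases "x = one \<or> z = one")
    case True
    then show ?thesis
      using unit x z by (auto simp: drastic_product_def)
  next
    case False
    then have not_one: "T x z \<noteq> one"
      using pseudo_t_norm_le_right[OF T x z] one_le_iff[OF z] by auto
    have "(one, z) \<noteq> (zero, zero)"
      using False by auto
    then have "T x (drastic_product zero one one z)
        = drastic_product zero one (T x one) (T x z)"
      using dist x z one_in False unfolding distributive_over_def by blast
    then show ?thesis
      using False not_one unit(2)[OF x] by (simp add: drastic_product_def)
  qed
qed

end

theorem proposition5p1:
  fixes X :: "'a set" and le :: "'a \<Rightarrow> 'a \<Rightarrow> bool"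
    and meet join :: "'a \<Rightarrow> 'a \<Rightarrow> 'a" and zero one :: 'a
    and Tstar :: "'a \<Rightarrow> 'a \<Rightarrow> 'a"
  assumes "bounded_trellis X le meet join zero one"
    and "pseudo_t_norm X le meet join one Tstar"
    and "\<And>T. pseudo_t_norm X le meet join one T \<Longrightarrow> distributive_over X zero one Tstar T"
  shows "t_norm X le one Tstar"
proof -
  interpret bounded_trellis X le meet join zero one by (rule assms(1))
  have "distributive_over X zero one Tstar (drastic_product zero one)"
    using drastic_product_t_norm by (intro assms(3) t_norm_imp_pseudo_t_norm)
  then show ?thesis
    using t_norm_cong[OF drastic_product_t_norm _ one_in]
      distributive_over_drastic_product_imp_eq[OF assms(2)] by blast
qed

end
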